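(* Let $P\subset\mathbb{R}^d$ be a $d$-dimensional lattice polytope, let $\mathcal{A}=P\cap\mathbb{Z}^d$, and let $T$ be a regular, dense and foldable triangulation of $P$. Let $\ell:\mathcal{A}\to\{0,1,\dots,d\}$ be a proper coloring of the vertices of $T$, let $\mathcal{A}_i=\{a\in\mathcal{A}\mid \ell(a)=i\}$, and let $\kappa=(\kappa_a)_{a\in\mathcal{A}}$ be positive real constants. Then there exists a height function $\omega:\mathcal{A}\to\mathbb{N}$ inducing $T$ such that, for all except finitely many values of $t\in\mathbb{R}\setminus\{0\}$, the system $$f_0=f_1=\dots=f_d=0,\qquad f_i(x)=\sum_{a\in\mathcal{A}_i}t^{\omega(a)}\kappa_a x^a\quad(0\le i\le d),$$ in the unknowns $x=(x_1,\dots,x_d)$ has no solutions in the torus $(\mathbb{C}\setminus\{0\})^d$.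
   Context: A lattice polytope in $\mathbb{R}^d$ is the convex hull of finitely many points of $\mathbb{Z}^d$. A triangulation $T$ of $P$ (with vertices in $\mathcal{A}=P\cap\mathbb{Z}^d$) is dense if its vertex set is all of $\mathcal{A}$. It is foldable if its graph ($1$-skeleton) admits a proper coloring with $d+1$ colors, i.e. a map $\ell:\mathcal{A}\to\{0,\dots,d\}$ such that the endpoints of every edge of $T$ have different colors. A height function $\omega:\mathcal{A}\to\mathbb{N}$ (nonnegative integers) induces $T$ if $T$ is the image of the lower convex hull of the lifted points $\{(a,\omega(a))\mid a\in\mathcal{A}\}\subset\mathbb{R}^{d+1}$ under the orthogonal projection omitting the last coordinate; $T$ is regular if it is induced by some height function. For $a\in\mathbb{Z}^d$, $x^a=x_1^{a_1}\cdots x_d^{a_d}$ (exponents may be negative). *)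

theory Defs
  imports "HOL-Analysis.Analysis"
begin

definition lattice_points :: "(real ^ 'd) set \<Rightarrow> (real ^ 'd) set" where
  "lattice_points P = {a \<in> P. \<forall>i. a $ i \<in> \<int>}"

definition lattice_polytope :: "(real ^ 'd) set \<Rightarrow> bool" where
  "lattice_polytope P \<longleftrightarrow> (\<exists>S. finite S \<and> S \<subseteq> lattice_points UNIV \<and> P = convex hull S)"

definition complex_vertices :: "(real ^ 'd) set set \<Rightarrow> (real ^ 'd) set" where
  "complex_vertices T = {v. {v} \<in> T}"

text \<open>The library notion \<open>simplicial_complex\<close> is closed under all faces, so \<open>T\<close> contains
  the empty simplex as soon as it is nonempty.\<close>

definition lattice_triangulation_of :: "(real ^ 'd) set set \<Rightarrow> (real ^ 'd) set \<Rightarrow> bool" where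
  "lattice_triangulation_of T P \<longleftrightarrow>
     simplicial_complex T \<and> \<Union> T = P \<and> complex_vertices T \<subseteq> lattice_points P"

definition dense_triangulation :: "(real ^ 'd) set set \<Rightarrow> (real ^ 'd) set \<Rightarrow> bool" where
  "dense_triangulation T P \<longleftrightarrow> complex_vertices T = lattice_points P"

text \<open>The condition \<open>a \<noteq> b\<close> is needed because \<open>closed_segment a a = {a}\<close>.\<close>

definition proper_coloring ::
    "(real ^ 'd) set set \<Rightarrow> (real ^ 'd) set \<Rightarrow> (real ^ 'd \<Rightarrow> nat) \<Rightarrow> bool" where
  "proper_coloring T P l \<longleftrightarrow>
     (\<forall>a \<in> lattice_points P. l a \<in> {0..CARD('d)}) \<and>
     (\<forall>a b. a \<noteq> b \<and> closed_segment a b \<in> T \<longrightarrow> l a \<noteq> l b)"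

definition foldable :: "(real ^ 'd) set set \<Rightarrow> (real ^ 'd) set \<Rightarrow> bool" where
  "foldable T P \<longleftrightarrow> (\<exists>l. proper_coloring T P l)"

definition lifted_polytope :: "(real ^ 'd) set \<Rightarrow> (real ^ 'd \<Rightarrow> nat) \<Rightarrow> ((real ^ 'd) \<times> real) set" where
  "lifted_polytope P \<omega> = convex hull ((\<lambda>a. (a, real (\<omega> a))) ` lattice_points P)"

definition lower_hull :: "((real ^ 'd) \<times> real) set \<Rightarrow> ((real ^ 'd) \<times> real) set" where
  "lower_hull Q = {(x, h) \<in> Q. \<forall>h'. (x, h') \<in> Q \<longrightarrow> h \<le> h'}"

text \<open>The lower hull is regarded as a polyhedral complex: its cells are the faces of the lifted
  polytope that lie in it. The empty face is included, in accordance with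
  \<open>simplicial_complex\<close>.\<close>

definition induces :: "(real ^ 'd) set \<Rightarrow> (real ^ 'd \<Rightarrow> nat) \<Rightarrow> (real ^ 'd) set set \<Rightarrow> bool" where
  "induces P \<omega> T \<longleftrightarrow>
     T = {fst ` F |F. F face_of lifted_polytope P \<omega> \<and> F \<subseteq> lower_hull (lifted_polytope P \<omega>)}"

definition regular_triangulation :: "(real ^ 'd) set set \<Rightarrow> (real ^ 'd) set \<Rightarrow> bool" where
  "regular_triangulation T P \<longleftrightarrow> (\<exists>\<omega>. induces P \<omega> T)"

text \<open>Lattice points are real vectors with integral entries; the floor only converts these
  entries to type \<open>int\<close>.\<close>

definition laurent_monomial :: "complex ^ 'd \<Rightarrow> real ^ 'd \<Rightarrow> complex" where
  "laurent_monomial x a = (\<Prod>i\<in>UNIV. (x $ i) powi \<lfloor>a $ i\<rfloor>)"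

definition color_poly ::
    "(real ^ 'd) set \<Rightarrow> (real ^ 'd \<Rightarrow> nat) \<Rightarrow> (real ^ 'd \<Rightarrow> real) \<Rightarrow> (real ^ 'd \<Rightarrow> nat)
     \<Rightarrow> real \<Rightarrow> nat \<Rightarrow> complex ^ 'd \<Rightarrow> complex" where
  "color_poly P l \<kappa> \<omega> t i x =
     (\<Sum>a | a \<in> lattice_points P \<and> l a = i. of_real (t ^ \<omega> a * \<kappa> a) * laurent_monomial x a)"

end

theory Submission
  imports Defs "HOL-Computational_Algebra.Polynomial"
begin

text \<open>Every color class is nonempty, since the \<open>d + 1\<close> vertices of a full-dimensional simplex of \<open>T\<close>
  have distinct colors. Hence a coefficient vector \<open>c\<close> with nonzero entries whose system has a
  solution \<open>x\<close> in the torus is determined by \<open>x\<close> and all but \<open>d + 1\<close> of the entries of \<open>c\<close>, one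
  per equation. So all such \<open>c\<close> lie in the image of a Laurent polynomial map from an
  \<open>(n - 1)\<close>-dimensional torus to affine \<open>n\<close>-space, \<open>n\<close> the number of lattice points. By counting
  monomials, some nonzero polynomial \<open>R\<close> vanishes on this image.

  Since every lattice point is a vertex of \<open>T\<close>, inducing \<open>T\<close> amounts to finitely many strict
  inequalities that are linear and homogeneous in the heights. So if \<open>\<omega>\<close> induces \<open>T\<close>, then so does
  \<open>K \<omega> + \<eta>\<close> for any \<open>\<eta>\<close> and all large \<open>K\<close>. Choose \<open>\<eta>\<close> such that the monomials of \<open>R\<close> get distinct
  weights. Then substituting \<open>c a = t ^ (K * \<omega> a + \<eta> a) * \<kappa> a\<close> into \<open>R\<close> gives a nonzero polynomial
  in \<open>t\<close>, and every exceptional \<open>t\<close> is one of its roots.\<close>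

section \<open>Laurent polynomials and algebraic dependence\<close>

text \<open>Gaussian elimination, by induction on the equations \<open>Z\<close>: an equation with a
  nonzero coefficient at some unknown \<open>m0\<close> serves to eliminate that unknown, which
  lowers both counts by one.\<close>

lemma nontrivial_kernel:
  fixes c :: "'m \<Rightarrow> 'z \<Rightarrow> 'f::field"
  assumes "finite Z" "finite M" "card Z < card M"
  shows "\<exists>r. (\<exists>m\<in>M. r m \<noteq> 0) \<and> (\<forall>z\<in>Z. (\<Sum>m\<in>M. r m * c m z) = 0)"
  using assms
proof (induction Z arbitrary: M c rule: finite_induct)
  case empty
  then have "M \<noteq> {}" by auto
  then show ?case by (intro exI[of _ "\<lambda>_. 1"]) auto
next
  case (insert z Z)
  show ?case
  proof (cases "\<forall>m\<in>M. c m z = 0")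
    case True
    have "card Z < card M" using insert by simp
    then obtain r where "\<exists>m\<in>M. r m \<noteq> 0" "\<forall>z\<in>Z. (\<Sum>m\<in>M. r m * c m z) = 0"
      using insert.IH[of M c] insert.prems by blast
    then show ?thesis using True by (intro exI[of _ r]) auto
  next
    case False
    then obtain m0 where m0: "m0 \<in> M" "c m0 z \<noteq> 0" by blast
    \<comment> \<open>Column \<open>m0\<close> is subtracted with the factor that makes the entry at
      \<open>z\<close> vanish, so a relation among the new columns leaves only the value at
      \<open>m0\<close> to be found.\<close>
    define c' where "c' m y = c m y - c m z / c m0 z * c m0 y" for m y
    have "card Z < card (M - {m0})" "finite (M - {m0})" using insert m0 by auto
    from insert.IH[OF this(2,1), of c'] obtain r where r: "\<exists>m\<in>M-{m0}. r m \<noteq> 0"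
      "\<And>y. y \<in> Z \<Longrightarrow> (\<Sum>m\<in>M-{m0}. r m * c' m y) = 0" by blast
    define s where "s = (\<Sum>m\<in>M-{m0}. r m * c m z)"
    \<comment> \<open>The value at \<open>m0\<close> is the one that equation \<open>z\<close>
      forces.\<close>
    define r' where "r' = r(m0 := - s / c m0 z)"
    have split: "(\<Sum>m\<in>M. r' m * c m y) = - s / c m0 z * c m0 y + (\<Sum>m\<in>M-{m0}. r m * c m y)" for y
    proof -
      have "(\<Sum>m\<in>M. r' m * c m y) = r' m0 * c m0 y + (\<Sum>m\<in>M-{m0}. r' m * c m y)"
        using insert.prems m0 by (simp add: sum.remove)
      also have "(\<Sum>m\<in>M-{m0}. r' m * c m y) = (\<Sum>m\<in>M-{m0}. r m * c m y)"
        by (rule sum.cong) (auto simp: r'_def)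
      finally show ?thesis by (simp add: r'_def)
    qed
    have "(\<Sum>m\<in>M. r' m * c m y) = 0" if "y \<in> insert z Z" for y
    proof (cases "y = z")
      case True
      then show ?thesis using m0 by (simp add: split s_def)
    next
      case False
      then have "(\<Sum>m\<in>M-{m0}. r m * c m y - r m * c m z * (c m0 y / c m0 z)) = 0"
        using r(2)[of y] that by (simp add: c'_def algebra_simps)
      then have "(\<Sum>m\<in>M-{m0}. r m * c m y) = s * (c m0 y / c m0 z)"
        by (simp only: sum_subtractf s_def sum_distrib_right right_minus_eq)
      then show ?thesis by (simp add: split)
    qed
    moreover have "\<exists>m\<in>M. r' m \<noteq> 0" using r(1) by (auto simp: r'_def)
    ultimately show ?thesis by blast
  qed
qed

text \<open>Only the values on the torus are constrained: \<open>powi\<close> does not turn sums of exponents into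
  products at \<open>0\<close>.\<close>

definition laurent_upto :: "'j set \<Rightarrow> nat \<Rightarrow> (('j \<Rightarrow> complex) \<Rightarrow> complex) set" where
  "laurent_upto J k = {f. \<exists>q. \<forall>p. (\<forall>j\<in>J. p j \<noteq> 0) \<longrightarrow>
     f p = (\<Sum>e\<in>PiE J (\<lambda>_. {- int k..int k}). q e * (\<Prod>j\<in>J. p j powi e j))}"

lemma laurent_upto_zero: "(\<lambda>p. 0) \<in> laurent_upto J k"
  unfolding laurent_upto_def by (auto intro!: exI[of _ "\<lambda>_. 0"])

lemma laurent_upto_add:
  assumes "f \<in> laurent_upto J k" "g \<in> laurent_upto J k"
  shows "(\<lambda>p. f p + g p) \<in> laurent_upto J k"
proof -
  from assms obtain q r where
    "\<And>p. \<forall>j\<in>J. p j \<noteq> 0 \<Longrightarrow> f p = (\<Sum>e\<in>PiE J (\<lambda>_. {- int k..int k}). q e * (\<Prod>j\<in>J. p j powi e j))"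
    "\<And>p. \<forall>j\<in>J. p j \<noteq> 0 \<Longrightarrow> g p = (\<Sum>e\<in>PiE J (\<lambda>_. {- int k..int k}). r e * (\<Prod>j\<in>J. p j powi e j))"
    unfolding laurent_upto_def by blast
  then show ?thesis unfolding laurent_upto_def
    by (auto intro!: exI[of _ "\<lambda>e. q e + r e"] simp: distrib_right sum.distrib)
qed

lemma laurent_upto_scale:
  assumes "f \<in> laurent_upto J k"
  shows "(\<lambda>p. c * f p) \<in> laurent_upto J k"
proof -
  from assms obtain q where
    "\<And>p. \<forall>j\<in>J. p j \<noteq> 0 \<Longrightarrow> f p = (\<Sum>e\<in>PiE J (\<lambda>_. {- int k..int k}). q e * (\<Prod>j\<in>J. p j powi e j))"
    unfolding laurent_upto_def by blast
  then show ?thesis unfolding laurent_upto_def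
    by (auto intro!: exI[of _ "\<lambda>e. c * q e"] simp: sum_distrib_left mult.assoc)
qed

lemma laurent_upto_sum:
  assumes "\<And>i. i \<in> I \<Longrightarrow> f i \<in> laurent_upto J k"
  shows "(\<lambda>p. \<Sum>i\<in>I. f i p) \<in> laurent_upto J k"
  using assms
  by (induction I rule: infinite_finite_induct) (auto intro: laurent_upto_zero laurent_upto_add)

lemma laurent_upto_monomial:
  assumes "finite J" "\<And>j. j \<in> J \<Longrightarrow> \<bar>e j\<bar> \<le> int k"
  shows "(\<lambda>p. \<Prod>j\<in>J. p j powi e j) \<in> laurent_upto J k"
proof -
  let ?E = "PiE J (\<lambda>_. {- int k..int k})"
  have e: "restrict e J \<in> ?E" using assms(2) by (fastforce simp: abs_le_iff)
  have fin: "finite ?E" using assms(1) by (intro finite_PiE) auto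
  have "(\<Prod>j\<in>J. p j powi e j)
      = (\<Sum>e'\<in>?E. (if e' = restrict e J then 1 else 0) * (\<Prod>j\<in>J. p j powi e' j))" for p :: "'a \<Rightarrow> complex"
  proof -
    have "(\<Sum>e'\<in>?E. (if e' = restrict e J then 1 else 0) * (\<Prod>j\<in>J. p j powi e' j))
      = (\<Sum>e'\<in>?E. if e' = restrict e J then (\<Prod>j\<in>J. p j powi e' j) else 0)"
      by (rule sum.cong) auto
    also have "\<dots> = (\<Prod>j\<in>J. p j powi restrict e J j)" using e fin by (simp add: sum.delta)
    also have "\<dots> = (\<Prod>j\<in>J. p j powi e j)" by (rule prod.cong) auto
    finally show ?thesis by simp
  qed
  then show ?thesis unfolding laurent_upto_def mem_Collect_eq
    by (intro exI[of _ "\<lambda>e'. if e' = restrict e J then 1 else 0"] allI impI)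
qed

lemma laurent_upto_powi:
  assumes "finite J" "j \<in> J"
  shows "(\<lambda>p. p j powi z) \<in> laurent_upto J (nat \<bar>z\<bar>)"
proof -
  have "(\<lambda>p. \<Prod>i\<in>J. p i powi (if i = j then z else 0)) \<in> laurent_upto J (nat \<bar>z\<bar>)"
    by (rule laurent_upto_monomial) (use assms in auto)
  moreover have "(\<Prod>i\<in>J. p i powi (if i = j then z else 0)) = p j powi z" for p :: "'a \<Rightarrow> complex"
  proof -
    have "(\<Prod>i\<in>J. p i powi (if i = j then z else 0)) = (\<Prod>i\<in>J. if i = j then p i powi z else 1)"
      by (rule prod.cong) auto
    then show ?thesis using assms by (simp add: prod.delta)
  qed
  ultimately show ?thesis by simp
qed

lemma laurent_upto_cong:
  assumes "f \<in> laurent_upto J k" "\<And>p. (\<And>j. j \<in> J \<Longrightarrow> p j \<noteq> 0) \<Longrightarrow> g p = f p"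
  shows "g \<in> laurent_upto J k"
  using assms unfolding laurent_upto_def by auto

lemma laurent_upto_mult:
  assumes "finite J" "f \<in> laurent_upto J k" "g \<in> laurent_upto J k'"
  shows "(\<lambda>p. f p * g p) \<in> laurent_upto J (k + k')"
proof -
  let ?E = "\<lambda>k. PiE J (\<lambda>_. {- int k..int k})"
  from assms obtain q r where qr:
    "\<And>p. \<forall>j\<in>J. p j \<noteq> 0 \<Longrightarrow> f p = (\<Sum>e\<in>?E k. q e * (\<Prod>j\<in>J. p j powi e j))"
    "\<And>p. \<forall>j\<in>J. p j \<noteq> 0 \<Longrightarrow> g p = (\<Sum>e\<in>?E k'. r e * (\<Prod>j\<in>J. p j powi e j))"
    unfolding laurent_upto_def by blast
  have "(\<lambda>p. \<Sum>e\<in>?E k. \<Sum>e'\<in>?E k'. q e * r e' * (\<Prod>j\<in>J. p j powi (e j + e' j)))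
      \<in> laurent_upto J (k + k')"
    by (intro laurent_upto_sum laurent_upto_scale laurent_upto_monomial assms(1))
       (fastforce simp: PiE_iff abs_le_iff)
  then show ?thesis
  proof (rule laurent_upto_cong)
    fix p :: "'a \<Rightarrow> complex" assume p: "\<And>j. j \<in> J \<Longrightarrow> p j \<noteq> 0"
    show "f p * g p = (\<Sum>e\<in>?E k. \<Sum>e'\<in>?E k'. q e * r e' * (\<Prod>j\<in>J. p j powi (e j + e' j)))"
      using p by (simp add: qr sum_product power_int_add prod.distrib mult_ac)
  qed
qed

text \<open>Multiplication by the trivial monomial, viewed as an element with bound
  \<open>k' - k\<close>, raises the bound.\<close>

lemma laurent_upto_mono:
  assumes "finite J" "f \<in> laurent_upto J k" "k \<le> k'"
  shows "f \<in> laurent_upto J k'"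
proof -
  have "(\<lambda>p. \<Prod>j\<in>J. p j powi (0::int)) \<in> laurent_upto J (k' - k)"
    by (rule laurent_upto_monomial) (use assms in auto)
  from laurent_upto_mult[OF assms(1,2) this] assms(3) show ?thesis by simp
qed

lemma laurent_upto_one: "finite J \<Longrightarrow> (\<lambda>p. 1) \<in> laurent_upto J k"
  using laurent_upto_monomial[of J "\<lambda>_. 0" k] by simp

lemma laurent_upto_power:
  assumes "finite J" "f \<in> laurent_upto J k"
  shows "(\<lambda>p. f p ^ n) \<in> laurent_upto J (n * k)"
  by (induction n) (use laurent_upto_one laurent_upto_mult assms in auto)

lemma laurent_upto_prod:
  assumes "finite J" "\<And>i. i \<in> I \<Longrightarrow> f i \<in> laurent_upto J (k i)"
  shows "(\<lambda>p. \<Prod>i\<in>I. f i p) \<in> laurent_upto J (\<Sum>i\<in>I. k i)"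
  using assms(2)
  by (induction I rule: infinite_finite_induct)
     (auto intro: laurent_upto_one laurent_upto_mult assms(1))

text \<open>A count of dimensions. The products of powers with exponents up to \<open>N\<close>
  number \<open>(N + 1) ^ card A\<close>, but they all lie in the span of the
  \<open>(2 * K + 1) ^ card J\<close> Laurent monomials with exponents up to \<open>K\<close>, where
  \<open>K\<close> is linear in \<open>N\<close>. Since \<open>card J < card A\<close>, a large
  \<open>N\<close> leaves more products than monomials, which forces a linear relation
  \<open>r\<close> among the products.\<close>

lemma laurent_algebraically_dependent:
  fixes \<phi> :: "'a \<Rightarrow> ('j \<Rightarrow> complex) \<Rightarrow> complex"
  assumes "finite J" "finite A" "card J < card A"
    and \<phi>: "\<phi> ` A \<subseteq> laurent_upto J k"
  shows "\<exists>N r. (\<exists>m\<in>PiE A (\<lambda>_. {..N}). r m \<noteq> 0) \<and>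
    (\<forall>p. (\<forall>j\<in>J. p j \<noteq> 0) \<longrightarrow> (\<Sum>m\<in>PiE A (\<lambda>_. {..N}). r m * (\<Prod>a\<in>A. \<phi> a p ^ m a)) = 0)"
proof -
  \<comment> \<open>These constants give \<open>2 * K + 1 \<le> C * (N + 1)\<close>, and with
    \<open>N = C ^ card J\<close> the number of monomials is at most
    \<open>N * (N + 1) ^ card J\<close>, just below \<open>(N + 1) ^ Suc (card J)\<close>.\<close>
  define C where "C = 2 * (card A * k) + 1"
  define N where "N = C ^ card J"
  define K where "K = card A * (N * k)"
  define M where "M = PiE A (\<lambda>_. {..N::nat})"
  define E where "E = PiE J (\<lambda>_. {- int K..int K})"
  have "(\<lambda>p. \<Prod>a\<in>A. \<phi> a p ^ m a) \<in> laurent_upto J K" if "m \<in> M" for m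
  proof -
    have "(\<lambda>p. \<Prod>a\<in>A. \<phi> a p ^ m a) \<in> laurent_upto J (\<Sum>a\<in>A. m a * k)"
      using \<phi> by (intro laurent_upto_prod laurent_upto_power assms(1)) auto
    moreover have "(\<Sum>a\<in>A. m a * k) \<le> K"
      unfolding K_def using that sum_bounded_above[of A "\<lambda>a. m a * k" "N * k"]
      by (auto simp: M_def PiE_iff)
    ultimately show ?thesis using laurent_upto_mono assms(1) by blast
  qed
  then have "\<forall>m\<in>M. \<exists>q. \<forall>p. (\<forall>j\<in>J. p j \<noteq> 0) \<longrightarrow>
     (\<Prod>a\<in>A. \<phi> a p ^ m a) = (\<Sum>e\<in>E. q e * (\<Prod>j\<in>J. p j powi e j))"
    unfolding laurent_upto_def E_def by blast
  then obtain q where q: "\<And>m p. m \<in> M \<Longrightarrow> \<forall>j\<in>J. p j \<noteq> 0 \<Longrightarrow>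
     (\<Prod>a\<in>A. \<phi> a p ^ m a) = (\<Sum>e\<in>E. q m e * (\<Prod>j\<in>J. p j powi e j))"
    using bchoice[of M "\<lambda>m q. \<forall>p. (\<forall>j\<in>J. p j \<noteq> 0) \<longrightarrow>
     (\<Prod>a\<in>A. \<phi> a p ^ m a) = (\<Sum>e\<in>E. q e * (\<Prod>j\<in>J. p j powi e j))"] by blast
  have "card E = (2 * K + 1) ^ card J"
    using assms(1) by (simp add: E_def card_PiE nat_add_distrib nat_mult_distrib)
  also have "\<dots> \<le> (C * (N + 1)) ^ card J"
    by (intro power_mono) (auto simp: C_def K_def algebra_simps)
  also have "\<dots> = N * (N + 1) ^ card J" by (simp only: N_def power_mult_distrib)
  also have "\<dots> < (N + 1) ^ Suc (card J)" by simp
  also have "\<dots> \<le> (N + 1) ^ card A" using assms(3) by (intro power_increasing) auto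
  also have "\<dots> = card M" using assms(2) by (simp add: M_def card_PiE)
  finally have "card E < card M" .
  moreover have "finite E" "finite M" using assms by (auto simp: E_def M_def intro!: finite_PiE)
  ultimately obtain r where r: "\<exists>m\<in>M. r m \<noteq> 0" "\<And>e. e \<in> E \<Longrightarrow> (\<Sum>m\<in>M. r m * q m e) = 0"
    using nontrivial_kernel[of E M q] by blast
  have "(\<Sum>m\<in>M. r m * (\<Prod>a\<in>A. \<phi> a p ^ m a)) = 0" if p: "\<forall>j\<in>J. p j \<noteq> 0" for p
  proof -
    have "(\<Sum>m\<in>M. r m * (\<Prod>a\<in>A. \<phi> a p ^ m a))
        = (\<Sum>m\<in>M. \<Sum>e\<in>E. r m * q m e * (\<Prod>j\<in>J. p j powi e j))"
      using p by (intro sum.cong) (auto simp: q sum_distrib_left mult.assoc)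
    also have "\<dots> = (\<Sum>e\<in>E. (\<Sum>m\<in>M. r m * q m e) * (\<Prod>j\<in>J. p j powi e j))"
      by (subst sum.swap) (simp add: sum_distrib_right)
    also have "\<dots> = 0" by (simp add: r)
    finally show ?thesis .
  qed
  with r(1) show ?thesis unfolding M_def by blast
qed

section \<open>Generic weights\<close>

text \<open>Positional notation: each new element receives a weight beyond every sum attained so
  far, so the exponents can be read off as digits.\<close>

lemma exists_separating_weights:
  assumes "finite A"
  shows "\<exists>\<eta> :: 'a \<Rightarrow> nat. inj_on (\<lambda>m. \<Sum>a\<in>A. \<eta> a * m a) (PiE A (\<lambda>_. {..N}))"
  using assms
proof (induction A rule: finite_induct)
  case empty
  then show ?case by simp
next
  case (insert b A)
  then obtain \<eta> :: "'a \<Rightarrow> nat" where \<eta>: "inj_on (\<lambda>m. \<Sum>a\<in>A. \<eta> a * m a) (PiE A (\<lambda>_. {..N}))" by blast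
  \<comment> \<open>\<open>B\<close> exceeds every value attained on \<open>A\<close>, so division by \<open>B\<close> recovers \<open>m b\<close>.\<close>
  define B where "B = Suc (\<Sum>a\<in>A. \<eta> a * N)"
  define \<eta>' where "\<eta>' = \<eta>(b := B)"
  have S: "(\<Sum>a\<in>insert b A. \<eta>' a * m a) = B * m b + (\<Sum>a\<in>A. \<eta> a * m a)" for m
  proof -
    have "(\<Sum>a\<in>A. \<eta>' a * m a) = (\<Sum>a\<in>A. \<eta> a * m a)"
      using insert.hyps by (intro sum.cong) (auto simp: \<eta>'_def)
    then show ?thesis using insert.hyps by (simp add: \<eta>'_def)
  qed
  have "inj_on (\<lambda>m. \<Sum>a\<in>insert b A. \<eta>' a * m a) (PiE (insert b A) (\<lambda>_. {..N}))"
  proof (rule inj_onI)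
    fix m m' assume m: "m \<in> PiE (insert b A) (\<lambda>_. {..N})" "m' \<in> PiE (insert b A) (\<lambda>_. {..N})"
      and eq: "(\<Sum>a\<in>insert b A. \<eta>' a * m a) = (\<Sum>a\<in>insert b A. \<eta>' a * m' a)"
    have lt: "(\<Sum>a\<in>A. \<eta> a * f a) < B" if "f \<in> PiE (insert b A) (\<lambda>_. {..N})" for f
      unfolding B_def using that by (intro le_imp_less_Suc sum_mono mult_le_mono) (auto simp: PiE_iff)
    have "B * m b + (\<Sum>a\<in>A. \<eta> a * m a) = B * m' b + (\<Sum>a\<in>A. \<eta> a * m' a)" using eq by (simp only: S)
    from arg_cong[OF this, of "\<lambda>x. x div B"] arg_cong[OF this, of "\<lambda>x. x mod B"] lt[OF m(1)] lt[OF m(2)]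
    have mb: "m b = m' b" and ms: "(\<Sum>a\<in>A. \<eta> a * m a) = (\<Sum>a\<in>A. \<eta> a * m' a)" by auto
    have "(\<Sum>a\<in>A. \<eta> a * restrict m A a) = (\<Sum>a\<in>A. \<eta> a * restrict m' A a)" using ms by simp
    moreover have "restrict m A \<in> PiE A (\<lambda>_. {..N})" "restrict m' A \<in> PiE A (\<lambda>_. {..N})"
      using m by (auto simp: PiE_iff)
    ultimately have "restrict m A = restrict m' A" using inj_onD[OF \<eta>] by blast
    then have "m a = m' a" if "a \<in> insert b A" for a
      using mb that by (metis insertE restrict_apply')
    then show "m = m'" using m by (intro PiE_ext) 
  qed
  then show ?case by blast
qed

text \<open>Modulo \<open>K\<close> the new weight of \<open>m\<close> is its old one, which is
  smaller than \<open>K\<close> and hence recovered exactly. So adding a large multiple of any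
  heights keeps the weights distinct.\<close>

lemma separating_weights_add_multiple:
  assumes "finite A" "inj_on (\<lambda>m. \<Sum>a\<in>A. \<eta> a * m a) (PiE A (\<lambda>_. {..N}))"
    and K: "(\<Sum>a\<in>A. \<eta> a * N) < (K::nat)"
  shows "inj_on (\<lambda>m. \<Sum>a\<in>A. (K * \<omega> a + \<eta> a) * m a) (PiE A (\<lambda>_. {..N}))"
proof (rule inj_onI)
  fix m m' assume m: "m \<in> PiE A (\<lambda>_. {..N})" "m' \<in> PiE A (\<lambda>_. {..N})"
    and eq: "(\<Sum>a\<in>A. (K * \<omega> a + \<eta> a) * m a) = (\<Sum>a\<in>A. (K * \<omega> a + \<eta> a) * m' a)"
  have S: "(\<Sum>a\<in>A. (K * \<omega> a + \<eta> a) * f a) = (\<Sum>a\<in>A. \<eta> a * f a) + K * (\<Sum>a\<in>A. \<omega> a * f a)" for f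
    by (simp add: algebra_simps sum.distrib sum_distrib_left)
  have lt: "(\<Sum>a\<in>A. \<eta> a * f a) < K" if "f \<in> PiE A (\<lambda>_. {..N})" for f
    by (rule le_less_trans[OF _ K]) (use that in \<open>auto simp: PiE_iff intro!: sum_mono\<close>)
  have "(\<Sum>a\<in>A. \<eta> a * m a) = (\<Sum>a\<in>A. \<eta> a * m' a)"
    using arg_cong[OF eq, of "\<lambda>x. x mod K"] lt[OF m(1)] lt[OF m(2)] by (simp add: S)
  then show "m = m'" using inj_onD[OF assms(2)] m by blast
qed

text \<open>Distinct exponents exclude cancellation: the coefficient at degree \<open>w m0\<close>
  is \<open>r m0\<close> alone, so the sum is a nonzero polynomial in \<open>t\<close>.\<close>

lemma finite_roots_of_separated_exponents:
  fixes r :: "'m \<Rightarrow> complex"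
  assumes "finite M" "m0 \<in> M" "r m0 \<noteq> 0" "inj_on w M"
  shows "finite {t::real. (\<Sum>m\<in>M. r m * of_real t ^ w m) = 0}"
proof -
  define p where "p = (\<Sum>m\<in>M. monom (r m) (w m))"
  have "coeff p (w m0) = (\<Sum>m\<in>M. if m = m0 then r m else 0)"
    unfolding p_def coeff_sum by (rule sum.cong) (use assms in \<open>auto simp: inj_on_eq_iff\<close>)
  then have "p \<noteq> 0" using assms by (auto simp: sum.delta)
  then have "finite (of_real -` {z. poly p z = 0} :: real set)"
    by (intro finite_vimageI poly_roots_finite) (auto simp: inj_on_def)
  moreover have "{t::real. (\<Sum>m\<in>M. r m * of_real t ^ w m) = 0} = of_real -` {z. poly p z = 0}"
    by (auto simp: p_def poly_sum poly_monom)
  ultimately show ?thesis by simp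
qed


section \<open>The eliminant of a colored system\<close>

lemma laurent_monomial_nonzero:
  assumes "\<And>j. x $ j \<noteq> 0"
  shows "laurent_monomial x a \<noteq> 0"
  using assms by (simp add: laurent_monomial_def)

lemma laurent_monomial_quotient:
  assumes "\<And>j. x $ j \<noteq> 0"
  shows "laurent_monomial x b
    = laurent_monomial x a * (\<Prod>j\<in>UNIV. x $ j powi (\<lfloor>b $ j\<rfloor> - \<lfloor>a $ j\<rfloor>))"
  unfolding laurent_monomial_def prod.distrib[symmetric]
  by (rule prod.cong) (use assms in \<open>auto simp flip: power_int_add\<close>)

text \<open>One representative is chosen per color, and the equation of that color is solved for its
  coefficient. The coordinates of \<open>x\<close> and the remaining coefficients then parametrize
  all coefficient vectors in question by Laurent polynomials in one variable fewer than
  \<open>card A\<close>. The relation \<open>r\<close> among these is found before \<open>c\<close>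
  and \<open>x\<close> are given.\<close>

lemma colored_system_eliminant:
  fixes A :: "(real ^ 'd) set" and l :: "real ^ 'd \<Rightarrow> nat"
  assumes "finite A" and surj: "{0..CARD('d)} \<subseteq> l ` A"
  shows "\<exists>N r. (\<exists>m\<in>PiE A (\<lambda>_. {..N}). r m \<noteq> 0) \<and>
    (\<forall>c (x :: complex ^ 'd). (\<forall>a\<in>A. c a \<noteq> 0) \<longrightarrow> (\<forall>j. x $ j \<noteq> 0) \<longrightarrow>
       (\<forall>i\<in>{0..CARD('d)}. (\<Sum>a | a \<in> A \<and> l a = i. c a * laurent_monomial x a) = 0) \<longrightarrow>
       (\<Sum>m\<in>PiE A (\<lambda>_. {..N}). r m * (\<Prod>a\<in>A. c a ^ m a)) = 0)"
proof -
  have "\<forall>i\<in>{0..CARD('d)}. \<exists>a\<in>A. l a = i" using surj by (auto simp: image_iff)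
  then obtain rep where rep: "\<And>i. i \<in> {0..CARD('d)} \<Longrightarrow> rep i \<in> A"
    "\<And>i. i \<in> {0..CARD('d)} \<Longrightarrow> l (rep i) = i" by metis
  define R where "R = rep ` {0..CARD('d)}"
  have R: "R \<subseteq> A" using rep by (auto simp: R_def)
  have lR: "a = rep (l a)" "l a \<in> {0..CARD('d)}" if "a \<in> R" for a
    using that rep(2) by (auto simp: R_def)
  have "inj_on rep {0..CARD('d)}" by (metis inj_onI rep(2))
  then have cardR: "card R = CARD('d) + 1" by (simp add: R_def card_image)
  \<comment> \<open>\<open>Inl j\<close> stands for the coordinate \<open>x $ j\<close> and
    \<open>Inr b\<close> for the coefficient at \<open>b\<close>. The size is
    \<open>CARD('d) + (card A - (CARD('d) + 1)) = card A - 1\<close>.\<close>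
  define J :: "('d + real ^ 'd) set" where "J = UNIV <+> (A - R)"
  have finJ: "finite J" using assms(1) by (simp add: J_def)
  have "card J < card A"
    using cardR R assms(1) card_mono[OF assms(1) R]
    by (simp add: J_def card_Plus card_Diff_subset finite_subset)
  define q where "q a b p = (\<Prod>j\<in>UNIV. p (Inl j) powi (\<lfloor>b $ j\<rfloor> - \<lfloor>a $ j\<rfloor>))"
    for a b :: "real ^ 'd" and p :: "'d + real ^ 'd \<Rightarrow> complex"
  \<comment> \<open>At a representative this is the solution of its equation, with the monomial of
    \<open>a\<close> divided out; elsewhere it is a free parameter.\<close>
  define \<phi> where "\<phi> a p = (if a \<in> R then - (\<Sum>b\<in>{b \<in> A. l b = l a} - {a}. p (Inr b) * q a b p) else p (Inr a))"
    for a and p :: "'d + real ^ 'd \<Rightarrow> complex"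
  define D where "D a b = (\<Sum>j\<in>UNIV. nat \<bar>\<lfloor>b $ j\<rfloor> - \<lfloor>a $ j\<rfloor>\<bar>)" for a b :: "real ^ 'd"
  \<comment> \<open>The summand 1 accounts for the factor \<open>p (Inr b)\<close>; the double sum
    bounds every single \<open>D a b\<close>.\<close>
  define k where "k = 1 + (\<Sum>a\<in>A. \<Sum>b\<in>A. D a b)"
  have D: "D a b \<le> (\<Sum>a\<in>A. \<Sum>b\<in>A. D a b)" if "a \<in> A" "b \<in> A" for a b
  proof -
    have "D a b \<le> (\<Sum>b\<in>A. D a b)" using that assms(1) by (intro member_le_sum) auto
    also have "\<dots> \<le> (\<Sum>a\<in>A. \<Sum>b\<in>A. D a b)"
      using that assms(1) by (intro member_le_sum[of a A "\<lambda>a. \<Sum>b\<in>A. D a b"]) auto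
    finally show ?thesis .
  qed
  have var: "(\<lambda>p. p (Inr b)) \<in> laurent_upto J 1" if "b \<in> A - R" for b
    using laurent_upto_powi[OF finJ, of "Inr b" 1] that by (auto simp: J_def)
  have q: "q a b \<in> laurent_upto J (D a b)" for a b
    unfolding q_def D_def by (intro laurent_upto_prod laurent_upto_powi finJ) (auto simp: J_def)
  have "\<phi> a \<in> laurent_upto J k" if "a \<in> A" for a
  proof (cases "a \<in> R")
    case True
    have "(\<lambda>p. p (Inr b) * q a b p) \<in> laurent_upto J k" if b: "b \<in> {b \<in> A. l b = l a} - {a}" for b
    proof -
      \<comment> \<open>Representatives of equal color coincide, so \<open>Inr b\<close> is indeed
        one of the parameters.\<close>
      have "b \<notin> R" using lR(1)[of a] lR(1)[of b] True b by auto
      then have "(\<lambda>p. p (Inr b) * q a b p) \<in> laurent_upto J (1 + D a b)"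
        using b by (intro laurent_upto_mult finJ var q) auto
      then show ?thesis
        using D[OF \<open>a \<in> A\<close>, of b] b by (elim laurent_upto_mono[OF finJ]) (auto simp: k_def)
    qed
    then have "(\<lambda>p. -1 * (\<Sum>b\<in>{b \<in> A. l b = l a} - {a}. p (Inr b) * q a b p)) \<in> laurent_upto J k"
      by (intro laurent_upto_scale laurent_upto_sum)
    then show ?thesis using True by (simp add: \<phi>_def[abs_def])
  next
    case False
    then show ?thesis using laurent_upto_mono[OF finJ var, of a k] that
      by (simp add: \<phi>_def[abs_def] k_def)
  qed
  then have "\<phi> ` A \<subseteq> laurent_upto J k" by blast
  from laurent_algebraically_dependent[OF finJ assms(1) \<open>card J < card A\<close> this]
  obtain N r where r: "\<exists>m\<in>PiE A (\<lambda>_. {..N}). r m \<noteq> 0"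
    "\<forall>p. (\<forall>j\<in>J. p j \<noteq> 0) \<longrightarrow> (\<Sum>m\<in>PiE A (\<lambda>_. {..N}). r m * (\<Prod>a\<in>A. \<phi> a p ^ m a)) = 0"
    by (elim exE conjE) (rule that)
  have "(\<Sum>m\<in>PiE A (\<lambda>_. {..N}). r m * (\<Prod>a\<in>A. c a ^ m a)) = 0"
    if c: "\<forall>a\<in>A. c a \<noteq> 0" and x: "\<forall>j. x $ j \<noteq> 0"
      and sys: "\<forall>i\<in>{0..CARD('d)}. (\<Sum>a | a \<in> A \<and> l a = i. c a * laurent_monomial x a) = 0"
    for c and x :: "complex ^ 'd"
  proof -
    \<comment> \<open>The parameter point that belongs to the given solution; \<open>\<phi>\<close>
      maps it back to \<open>c\<close>.\<close>
    define p where "p = case_sum (\<lambda>j. x $ j) c"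
    have \<phi>: "\<phi> a p = c a" if a: "a \<in> A" for a
    proof (cases "a \<in> R")
      case True
      let ?B = "{b \<in> A. l b = l a}"
      have "0 = (\<Sum>b\<in>?B. c b * laurent_monomial x b)" using sys lR(2)[OF True] by simp
      also have "\<dots> = c a * laurent_monomial x a + (\<Sum>b\<in>?B-{a}. c b * laurent_monomial x b)"
        using assms(1) a by (intro sum.remove) auto
      also have "(\<Sum>b\<in>?B-{a}. c b * laurent_monomial x b)
          = laurent_monomial x a * (\<Sum>b\<in>?B-{a}. c b * q a b p)"
        unfolding sum_distrib_left
      proof (rule sum.cong[OF refl])
        fix b
        have "laurent_monomial x b = laurent_monomial x a * q a b p"
          unfolding q_def p_def sum.case by (rule laurent_monomial_quotient) (use x in blast)
        then show "c b * laurent_monomial x b = laurent_monomial x a * (c b * q a b p)"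
          by (simp only: mult_ac)
      qed
      finally have "laurent_monomial x a * (c a + (\<Sum>b\<in>?B-{a}. c b * q a b p)) = 0"
        by (simp add: algebra_simps)
      then have "c a + (\<Sum>b\<in>?B-{a}. c b * q a b p) = 0"
        using laurent_monomial_nonzero[of x a] x by simp
      then show ?thesis using True by (simp add: \<phi>_def p_def eq_neg_iff_add_eq_0[symmetric])
    next
      case False
      then show ?thesis by (simp add: \<phi>_def p_def)
    qed
    have "\<forall>j\<in>J. p j \<noteq> 0" using c x by (auto simp: J_def p_def)
    with r(2) have "(\<Sum>m\<in>PiE A (\<lambda>_. {..N}). r m * (\<Prod>a\<in>A. \<phi> a p ^ m a)) = 0" by blast
    then show ?thesis using \<phi> by simp
  qed
  then show ?thesis using r(1) by (intro exI[of _ N] exI[of _ r] conjI allI impI)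
qed

text \<open>The eliminant, evaluated at
  \<open>c a = t ^ (K * \<omega> a + \<eta> a) * \<kappa> a\<close>, becomes a polynomial in
  \<open>t\<close> whose terms have distinct degrees once \<open>K\<close> is large; its finitely
  many roots contain all \<open>t\<close> in question. Every large \<open>K\<close> is allowed, so
  that \<open>K\<close> can later be chosen to preserve the triangulation as well.\<close>

lemma generic_heights_finite_solvable:
  fixes P :: "(real ^ 'd) set" and l :: "real ^ 'd \<Rightarrow> nat"
  assumes fin: "finite (lattice_points P)"
    and surj: "{0..CARD('d)} \<subseteq> l ` lattice_points P"
    and \<kappa>: "\<forall>a\<in>lattice_points P. \<kappa> a \<noteq> 0"
  shows "\<exists>\<eta> K0. \<forall>K>K0. finite {t :: real. t \<noteq> 0 \<and>
             (\<exists>x :: complex ^ 'd. (\<forall>j. x $ j \<noteq> 0) \<and>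
                (\<forall>i \<in> {0..CARD('d)}. color_poly P l \<kappa> (\<lambda>a. K * \<omega> a + \<eta> a) t i x = 0))}"
proof -
  define A where "A = lattice_points P"
  have "finite A" "{0..CARD('d)} \<subseteq> l ` A" using fin surj by (simp_all add: A_def)
  from colored_system_eliminant[OF this]
  obtain N r where r0: "\<exists>m\<in>PiE A (\<lambda>_. {..N}). r m \<noteq> 0" and
    r: "\<forall>c (x :: complex ^ 'd). (\<forall>a\<in>A. c a \<noteq> 0) \<longrightarrow> (\<forall>j. x $ j \<noteq> 0) \<longrightarrow>
       (\<forall>i\<in>{0..CARD('d)}. (\<Sum>a | a \<in> A \<and> l a = i. c a * laurent_monomial x a) = 0) \<longrightarrow>
       (\<Sum>m\<in>PiE A (\<lambda>_. {..N}). r m * (\<Prod>a\<in>A. c a ^ m a)) = 0"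
    by (elim exE conjE) (rule that)
  from r0 obtain m0 where m0: "m0 \<in> PiE A (\<lambda>_. {..N})" "r m0 \<noteq> 0" by blast
  obtain \<eta> where \<eta>: "inj_on (\<lambda>m. \<Sum>a\<in>A. \<eta> a * m a) (PiE A (\<lambda>_. {..N}))"
    using exists_separating_weights fin A_def by blast
  let ?\<kappa> = "\<lambda>m. \<Prod>a\<in>A. of_real (\<kappa> a) ^ m a :: complex"
  have "finite {t :: real. t \<noteq> 0 \<and> (\<exists>x :: complex ^ 'd. (\<forall>j. x $ j \<noteq> 0) \<and>
          (\<forall>i \<in> {0..CARD('d)}. color_poly P l \<kappa> (\<lambda>a. K * \<omega> a + \<eta> a) t i x = 0))}"
    if K: "K > (\<Sum>a\<in>A. \<eta> a * N)" for K
  proof -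
    let ?w = "\<lambda>m. \<Sum>a\<in>A. (K * \<omega> a + \<eta> a) * m a"
    have "inj_on ?w (PiE A (\<lambda>_. {..N}))"
      using separating_weights_add_multiple \<eta> K fin A_def by blast
    moreover have "r m0 * ?\<kappa> m0 \<noteq> 0" using m0 \<kappa> fin by (fastforce simp: A_def)
    moreover have "finite (PiE A (\<lambda>_. {..N}))" using fin by (auto simp: A_def intro!: finite_PiE)
    ultimately have "finite {t::real. (\<Sum>m\<in>PiE A (\<lambda>_. {..N}). r m * ?\<kappa> m * of_real t ^ ?w m) = 0}"
      using m0 by (intro finite_roots_of_separated_exponents)
    moreover have "(\<Sum>m\<in>PiE A (\<lambda>_. {..N}). r m * ?\<kappa> m * of_real t ^ ?w m) = 0"
      if t: "t \<noteq> 0" and x: "\<forall>j. x $ j \<noteq> 0"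
        and sys: "\<forall>i \<in> {0..CARD('d)}. color_poly P l \<kappa> (\<lambda>a. K * \<omega> a + \<eta> a) t i x = 0"
      for t :: real and x :: "complex ^ 'd"
    proof -
      let ?c = "\<lambda>a. of_real (t ^ (K * \<omega> a + \<eta> a) * \<kappa> a) :: complex"
      have "(\<Prod>a\<in>A. ?c a ^ m a) = of_real t ^ ?w m * ?\<kappa> m" for m
        by (simp add: power_mult_distrib prod.distrib power_sum power_mult)
      then have eq: "(\<Sum>m\<in>PiE A (\<lambda>_. {..N}). r m * ?\<kappa> m * of_real t ^ ?w m)
          = (\<Sum>m\<in>PiE A (\<lambda>_. {..N}). r m * (\<Prod>a\<in>A. ?c a ^ m a))"
        by (simp only: mult_ac)
      show ?thesis unfolding eq
      proof (rule r[rule_format, OF _ x[rule_format]])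
        show "?c a \<noteq> 0" if "a \<in> A" for a using \<kappa> t that by (simp add: A_def)
        show "(\<Sum>a | a \<in> A \<and> l a = i. ?c a * laurent_monomial x a) = 0" if "i \<in> {0..CARD('d)}" for i
          using sys that unfolding color_poly_def A_def by blast
      qed
    qed
    ultimately show ?thesis by (elim finite_subset[rotated]) blast
  qed
  then show ?thesis by (intro exI[of _ \<eta>] exI[of _ "\<Sum>a\<in>A. \<eta> a * N"] allI impI)
qed

section \<open>Heights inducing a triangulation\<close>

text \<open>Moving one point of \<open>V\<close> to the origin makes the others linearly
  independent, and values on an independent set extend linearly.\<close>

lemma affine_interpolation:
  fixes V :: "'a::euclidean_space set"
  assumes "\<not> affine_dependent V"
  shows "\<exists>f c. linear f \<and> (\<forall>v\<in>V. f v + c = (g v :: real))"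
proof (cases "V = {}")
  case True
  then show ?thesis using linear_zero by blast
next
  case False
  then obtain v0 where v0: "v0 \<in> V" by blast
  have "independent ((\<lambda>x. - v0 + x) ` (V - {v0}))"
    using assms affine_dependent_iff_dependent2[OF v0] by simp
  from linear_independent_extend[OF this, of "\<lambda>y. g (v0 + y) - g v0"]
  obtain f where f: "linear f"
    "\<forall>y\<in>(\<lambda>x. - v0 + x) ` (V - {v0}). f y = g (v0 + y) - g v0" by blast
  then have f2: "f (- v0 + v) = g v - g v0" if "v \<in> V - {v0}" for v using that by force
  have "f v + (g v0 - f v0) = g v" if "v \<in> V" for v
    using f2[of v] that by (cases "v = v0") (auto simp: linear_add[OF f(1)] linear_diff[OF f(1)])
  then show ?thesis using f(1) by blast
qed

text \<open>The lifting is an injective linear map followed by a translation, and both preserve and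
  reflect faces.\<close>

lemma face_of_affine_graph:
  fixes f :: "'a::euclidean_space \<Rightarrow> real"
  assumes "linear f"
  shows "(\<lambda>x. (x, f x + c)) ` F face_of (\<lambda>x. (x, f x + c)) ` S \<longleftrightarrow> F face_of S"
proof -
  let ?g = "\<lambda>x. (x, f x)"
  have "linear ?g"
    using assms by (intro linearI) (auto simp: linear_add linear_scale)
  moreover have "inj ?g" by (simp add: inj_on_def)
  moreover have "(\<lambda>x. (x, f x + c)) ` X = (+) (0, c) ` ?g ` X" for X
    by (auto simp: image_image add.commute)
  ultimately show ?thesis by (simp only: face_of_translation_eq face_of_linear_image)
qed

lemma convex_affine_graph_vimage:
  assumes "linear f" "convex F"
  shows "convex {x. (x, f x + (c::real)) \<in> F}"
proof (rule convexI)
  fix x y and u v :: real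
  assume "x \<in> {x. (x, f x + c) \<in> F}" "y \<in> {x. (x, f x + c) \<in> F}"
    and uv: "0 \<le> u" "0 \<le> v" "u + v = 1"
  then have "u *\<^sub>R (x, f x + c) + v *\<^sub>R (y, f y + c) \<in> F"
    using assms(2) by (intro convexD) auto
  moreover have "u * c + v * c = c" using uv by (metis distrib_right mult_1)
  then have "u *\<^sub>R (x, f x + c) + v *\<^sub>R (y, f y + c)
      = (u *\<^sub>R x + v *\<^sub>R y, f (u *\<^sub>R x + v *\<^sub>R y) + c)"
    by (simp add: linear_add[OF assms(1)] linear_scale[OF assms(1)] algebra_simps)
  ultimately show "u *\<^sub>R x + v *\<^sub>R y \<in> {x. (x, f x + c) \<in> F}" by simp
qed

section \<open>Full-dimensional simplices of a triangulation\<close>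

definition full_simplex :: "(real ^ 'd) set set \<Rightarrow> (real ^ 'd) set \<Rightarrow> bool" where
  "full_simplex T V \<longleftrightarrow> \<not> affine_dependent V \<and> card V = CARD('d) + 1 \<and> convex hull V \<in> T"

lemma full_simplex_affine_hull:
  fixes V :: "(real ^ 'd) set"
  assumes "full_simplex T V"
  shows "affine hull V = UNIV"
  using assms aff_dim_affine_independent[of V]
  by (simp add: full_simplex_def aff_dim_eq_full[symmetric])

text \<open>The simplices of lower dimension are finitely many closed sets with empty interior, so
  the interior of the convex set \<open>\<Union> T\<close> is that of the union of the
  full-dimensional ones. This union is closed, and a convex set with nonempty interior lies in the
  closure of its interior.\<close>

lemma full_simplices_cover:
  fixes T :: "(real ^ 'd) set set"
  assumes T: "simplicial_complex T" and "convex (\<Union> T)" "aff_dim (\<Union> T) = int CARD('d)"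
    and x: "x \<in> \<Union> T"
  obtains V where "full_simplex T V" "x \<in> convex hull V"
proof -
  have simp: "\<exists>n. n simplex S" if "S \<in> T" for S using T that by (auto simp: simplicial_complex_def)
  have fin: "finite T" using T by (simp add: simplicial_complex_def)
  have cl: "closed S" if "S \<in> T" for S
    using simp[OF that] by (auto simp: simplex compact_convex_hull finite_imp_compact compact_imp_closed)
  let ?H = "{S \<in> T. interior S \<noteq> {}}" and ?L = "{S \<in> T. interior S = {}}"
  have lowdim: "interior (\<Union>L) = {}" if "finite L" "L \<subseteq> ?L" for L
    using that
  proof (induction L rule: finite_induct)
    case (insert S L)
    then have "interior (S \<union> \<Union>L) = interior S"
      using cl by (intro interior_closed_Un_empty_interior) auto
    then show ?case using insert by auto
  qed simp
  have clH: "closed (\<Union>?H)" using fin cl by (intro closed_Union) auto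
  have "\<Union>T = \<Union>?H \<union> \<Union>?L" by blast
  then have "interior (\<Union>T) = interior (\<Union>?H)"
    using interior_closed_Un_empty_interior[OF clH lowdim[of ?L]] fin by simp
  moreover have "affine hull (\<Union>T) = UNIV" using assms(3) by (simp add: aff_dim_eq_full[symmetric])
  then have "interior (\<Union>T) \<noteq> {}"
    using rel_interior_interior[of "\<Union>T"] rel_interior_eq_empty[OF assms(2)] x by auto
  ultimately have "closure (\<Union>T) = closure (interior (\<Union>?H))"
    using convex_closure_interior[OF assms(2)] by simp
  also have "\<dots> \<subseteq> \<Union>?H" using clH by (simp add: closure_minimal interior_subset)
  finally obtain S where S: "S \<in> T" "interior S \<noteq> {}" "x \<in> S"
    using x closure_subset by blast
  from simp[OF S(1)] obtain n V where V: "\<not> affine_dependent V" "int (card V) = n + 1" "S = convex hull V"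
    by (auto simp: simplex)
  have "aff_dim S = int CARD('d)"
    using affine_hull_nonempty_interior[OF S(2)] by (simp add: aff_dim_eq_full[symmetric])
  then have "card V = CARD('d) + 1"
    using aff_dim_affine_independent[OF V(1)] V(3) by (simp add: aff_dim_convex_hull)
  then show ?thesis using that S V by (simp add: full_simplex_def)
qed

text \<open>A vertex of the complex meets the simplex in a common face, so if it lies in the simplex
  it is an extreme point. For a dense triangulation this says that a simplex contains no lattice
  points besides its own vertices.\<close>

lemma simplex_vertices_eq:
  assumes T: "simplicial_complex T" and V: "\<not> affine_dependent V" "convex hull V \<in> T"
  shows "convex hull V \<inter> complex_vertices T = V"
proof
  show "convex hull V \<inter> complex_vertices T \<subseteq> V"
  proof
    fix a assume a: "a \<in> convex hull V \<inter> complex_vertices T"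
    then have "convex hull V \<inter> {a} face_of convex hull V"
      using T V unfolding simplicial_complex_def complex_vertices_def by blast
    then have "{a} face_of convex hull V" using a by simp
    then show "a \<in> V"
      using V(1) by (simp add: face_of_singleton extreme_point_of_convex_hull_affine_independent)
  qed
  show "V \<subseteq> convex hull V \<inter> complex_vertices T"
  proof
    fix a assume a: "a \<in> V"
    then have "{a} face_of convex hull V"
      using V(1) by (simp add: face_of_singleton extreme_point_of_convex_hull_affine_independent)
    then have "{a} \<in> T" using T V(2) unfolding simplicial_complex_def by blast
    then show "a \<in> convex hull V \<inter> complex_vertices T"
      using a by (simp add: hull_inc complex_vertices_def)
  qed
qed

lemma finite_complex_vertices:
  assumes "simplicial_complex T"
  shows "finite (complex_vertices T)"
proof -
  have "finite ((\<lambda>v. {v}) -` T)"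
    using assms by (intro finite_vimageI) (auto simp: simplicial_complex_def)
  then show ?thesis by (simp add: complex_vertices_def vimage_def)
qed

section \<open>Strict convexity of heights and its stability\<close>

text \<open>The strict linear inequalities that replace \<open>induces\<close>, from which stability
  under perturbation is easily read off. They range over all lattice points outside
  \<open>V\<close>, not only over the vertices of adjacent simplices.\<close>

definition locally_convex_heights ::
    "(real ^ 'd) set \<Rightarrow> (real ^ 'd \<Rightarrow> nat) \<Rightarrow> (real ^ 'd) set set \<Rightarrow> bool" where
  "locally_convex_heights P \<omega> T \<longleftrightarrow> (\<forall>V. full_simplex T V \<longrightarrow>
     (\<exists>f c. linear f \<and> (\<forall>v\<in>V. f v + c = real (\<omega> v)) \<and>
        (\<forall>a\<in>lattice_points P - V. f a + c < real (\<omega> a))))"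

text \<open>Interpolation is linear in the heights. The strict gap of \<open>\<omega>\<close> is
  multiplied by \<open>K\<close>, whereas the error caused by \<open>\<eta>\<close> stays fixed;
  only finitely many pairs of a simplex and a lattice point compete, so one bound serves
  all.\<close>

lemma locally_convex_heights_perturb:
  fixes T :: "(real ^ 'd) set set"
  assumes T: "simplicial_complex T" and A: "complex_vertices T = lattice_points P"
    and \<omega>: "locally_convex_heights P \<omega> T"
  shows "\<exists>K0. \<forall>K>K0. locally_convex_heights P (\<lambda>a. K * \<omega> a + \<eta> a) T"
proof -
  have fin: "finite (lattice_points P)" using finite_complex_vertices[OF T] A by simp
  let ?G = "\<lambda>K V. \<exists>f c. linear f \<and> (\<forall>v\<in>V. f v + c = real (K * \<omega> v + \<eta> v)) \<and>
        (\<forall>a\<in>lattice_points P - V. f a + c < real (K * \<omega> a + \<eta> a))"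
  have "\<forall>\<^sub>F K in sequentially. ?G K V" if V: "full_simplex T V" for V
  proof -
    obtain f c where f: "linear f" "\<And>v. v \<in> V \<Longrightarrow> f v + c = real (\<omega> v)"
      "\<And>a. a \<in> lattice_points P - V \<Longrightarrow> f a + c < real (\<omega> a)"
      using \<omega> V unfolding locally_convex_heights_def by blast
    \<comment> \<open>The interpolant of \<open>\<eta>\<close> on \<open>V\<close> may exceed
      \<open>\<eta>\<close> elsewhere; that excess is what the gap has to outweigh.\<close>
    obtain g d where g: "linear g" "\<And>v. v \<in> V \<Longrightarrow> g v + d = real (\<eta> v)"
      using affine_interpolation[of V "\<lambda>v. real (\<eta> v)"] V by (auto simp: full_simplex_def)
    have "\<forall>\<^sub>F K in sequentially. \<forall>a\<in>lattice_points P - V.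
        g a + d - real (\<eta> a) < real K * (real (\<omega> a) - (f a + c))"
    proof (rule eventually_ball_finite)
      show "\<forall>a\<in>lattice_points P - V. \<forall>\<^sub>F K in sequentially.
        g a + d - real (\<eta> a) < real K * (real (\<omega> a) - (f a + c))"
      proof
        fix a assume "a \<in> lattice_points P - V"
        then have pos: "0 < real (\<omega> a) - (f a + c)" using f(3) by simp
        obtain n where "g a + d - real (\<eta> a) < real n * (real (\<omega> a) - (f a + c))"
          using reals_Archimedean3[OF pos] by blast
        then show "\<forall>\<^sub>F K in sequentially. g a + d - real (\<eta> a) < real K * (real (\<omega> a) - (f a + c))"
          using pos by (intro eventually_sequentiallyI[of n])
            (erule less_le_trans, auto intro: mult_right_mono)
      qed
    qed (use fin in simp)
    then show ?thesis
    proof (rule eventually_mono)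
      fix K assume K: "\<forall>a\<in>lattice_points P - V.
        g a + d - real (\<eta> a) < real K * (real (\<omega> a) - (f a + c))"
      have eq: "real K * f v + g v + (real K * c + d) = real K * (f v + c) + (g v + d)" for v
        by (simp add: algebra_simps)
      have "linear (\<lambda>x. real K * f x + g x)"
        using linear_compose_add[OF linear_compose_scale_right[OF f(1), of "real K"] g(1)] by simp
      moreover have "real K * f v + g v + (real K * c + d) = real (K * \<omega> v + \<eta> v)" if "v \<in> V" for v
        unfolding eq using f(2) g(2) that by simp
      moreover have "real K * f a + g a + (real K * c + d) < real (K * \<omega> a + \<eta> a)"
        if "a \<in> lattice_points P - V" for a
        using K that by (auto simp: algebra_simps)
      ultimately show "?G K V" by blast
    qed
  qed
  moreover have "{V. full_simplex T V} \<subseteq> Pow (lattice_points P)"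
    using simplex_vertices_eq[OF T] A unfolding full_simplex_def by blast
  then have "finite {V. full_simplex T V}" using fin finite_subset by blast
  ultimately have "\<forall>\<^sub>F K in sequentially. \<forall>V\<in>{V. full_simplex T V}. ?G K V"
    by (intro eventually_ball_finite) auto
  then obtain K0 where "\<And>K. K \<ge> K0 \<Longrightarrow> \<forall>V\<in>{V. full_simplex T V}. ?G K V"
    unfolding eventually_sequentially by blast
  then show ?thesis unfolding locally_convex_heights_def by (intro exI[of _ K0]) auto
qed

section \<open>Lower faces of the lifted polytope\<close>

lemma convex_lifted_polytope: "convex (lifted_polytope P \<omega>)"
  by (simp add: lifted_polytope_def)

lemma fst_convex_hull_graph:
  "fst ` (convex hull ((\<lambda>a. (a, g a)) ` B)) = convex hull B"
  by (simp add: convex_hull_linear_image[OF linear_fst] image_image)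

lemma lifted_polytope_face:
  assumes "finite (lattice_points P)" "F face_of lifted_polytope P \<omega>"
  obtains B where "B \<subseteq> lattice_points P" "F = convex hull ((\<lambda>a. (a, real (\<omega> a))) ` B)"
proof -
  have "compact ((\<lambda>a. (a, real (\<omega> a))) ` lattice_points P)"
    using assms(1) by (intro finite_imp_compact finite_imageI)
  from face_of_convex_hull_subset[OF this assms(2)[unfolded lifted_polytope_def]]
  obtain S where S: "S \<subseteq> (\<lambda>a. (a, real (\<omega> a))) ` lattice_points P" "F = convex hull S" .
  from subset_imageE[OF S(1)] obtain B where "B \<subseteq> lattice_points P"
    "S = (\<lambda>a. (a, real (\<omega> a))) ` B" .
  then show ?thesis using that S(2) by blast
qed

text \<open>The lower face over a full-dimensional simplex contains the graph of the interpolant. A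
  further lifted lattice point on or below that graph would be forced into the same face, hence
  would project into the simplex, which contains no lattice points but its vertices.\<close>

lemma induces_imp_locally_convex:
  fixes T :: "(real ^ 'd) set set"
  assumes T: "simplicial_complex T" and A: "complex_vertices T = lattice_points P"
    and ind: "induces P \<omega> T"
  shows "locally_convex_heights P \<omega> T"
  unfolding locally_convex_heights_def
proof (intro allI impI)
  fix V assume V: "full_simplex T V"
  let ?Q = "lifted_polytope P \<omega>" and ?S = "convex hull V"
  have fin: "finite (lattice_points P)" using finite_complex_vertices[OF T] A by simp
  have indep: "\<not> affine_dependent V" and "?S \<in> T" using V by (auto simp: full_simplex_def)
  then obtain F where F: "F face_of ?Q" "F \<subseteq> lower_hull ?Q" "?S = fst ` F"
    using ind by (auto simp: induces_def)
  obtain B where B: "B \<subseteq> lattice_points P" "F = convex hull ((\<lambda>a. (a, real (\<omega> a))) ` B)"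
    using lifted_polytope_face[OF fin F(1)] .
  have "?S = convex hull B"
    unfolding F(3) B(2) by (rule fst_convex_hull_graph)
  \<comment> \<open>The points of \<open>V\<close> are extreme in the simplex, and extreme points of
    a hull belong to every generating set.\<close>
  then have "V \<subseteq> B"
    using indep extreme_point_of_convex_hull
      extreme_point_of_convex_hull_affine_independent by (metis subsetI)
  then have VF: "(v, real (\<omega> v)) \<in> F" if "v \<in> V" for v
    using that B by (auto intro: hull_inc)
  obtain f c where f: "linear f" "\<And>v. v \<in> V \<Longrightarrow> f v + c = real (\<omega> v)"
    using affine_interpolation[OF indep, of "\<lambda>v. real (\<omega> v)"] by blast
  have "convex {x. (x, f x + c) \<in> F}"
    using f(1) face_of_imp_convex[OF F(1)] by (rule convex_affine_graph_vimage)
  then have "?S \<subseteq> {x. (x, f x + c) \<in> F}"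
    using VF f(2) by (intro hull_minimal) auto
  then have SF: "(x, f x + c) \<in> F" if "x \<in> ?S" for x using that by blast
  have "f a + c < real (\<omega> a)" if a: "a \<in> lattice_points P - V" for a
  proof (rule ccontr)
    assume "\<not> ?thesis"
    then have le: "real (\<omega> a) \<le> f a + c" by simp
    have aS: "a \<notin> ?S"
      using simplex_vertices_eq[OF T indep \<open>?S \<in> T\<close>] A a by auto
    have aQ: "(a, real (\<omega> a)) \<in> ?Q" using a by (auto simp: lifted_polytope_def intro: hull_inc)
    have "V \<noteq> {}" using V by (auto simp: full_simplex_def)
    then have "interior ?S \<noteq> {}"
      using rel_interior_interior[of ?S] rel_interior_eq_empty[of ?S] full_simplex_affine_hull[OF V]
      by simp
    then obtain p e where p: "e > 0" "ball p e \<subseteq> ?S" by (meson all_not_in_conv mem_interior)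
    then have pS: "p \<in> ?S" by auto
    then have "p \<noteq> a" using aS by auto
    \<comment> \<open>Extend the segment from \<open>a\<close> through the interior point \<open>p\<close> to a point \<open>q\<close> of the simplex: the
      chord over it passes through the lower face \<open>F\<close>, which therefore contains the lifted \<open>a\<close>.\<close>
    define s where "s = e / (2 * norm (p - a))"
    have s: "s > 0" using p \<open>p \<noteq> a\<close> by (simp add: s_def)
    define q where "q = p + s *\<^sub>R (p - a)"
    have "dist p q < e" using p \<open>p \<noteq> a\<close> by (simp add: q_def dist_norm s_def)
    then have qS: "q \<in> ?S" using p by auto
    \<comment> \<open>The weight of \<open>a\<close> for which the point of the segment from
      \<open>q\<close> to \<open>a\<close> is exactly \<open>p\<close>.\<close>
    define u where "u = s / (1 + s)"
    have u: "0 < u" "u < 1" "(1 - u) * (1 + s) = 1" "(1 - u) * s = u"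
      using s by (auto simp: u_def field_simps)
    have "(1 - u) *\<^sub>R q + u *\<^sub>R a = ((1 - u) * (1 + s)) *\<^sub>R p + (u - (1 - u) * s) *\<^sub>R a"
      by (simp add: q_def algebra_simps)
    then have pq: "(1 - u) *\<^sub>R q + u *\<^sub>R a = p" unfolding u(3,4) by simp
    define w where "w = (1 - u) *\<^sub>R (q, f q + c) + u *\<^sub>R (a, real (\<omega> a))"
    have w: "w = (p, (1 - u) * (f q + c) + u * real (\<omega> a))" using pq by (simp add: w_def)
    have "(q, f q + c) \<in> ?Q" using SF[OF qS] face_of_imp_subset[OF F(1)] by blast
    then have "w \<in> ?Q" unfolding w_def using u aQ by (intro convexD[OF convex_lifted_polytope]) auto
    have "(p, f p + c) \<in> lower_hull ?Q" using SF[OF pS] F(2) by blast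
    then have "f p + c \<le> snd w" using \<open>w \<in> ?Q\<close> w by (auto simp: lower_hull_def)
    moreover have "f p = (1 - u) * f q + u * f a"
      unfolding pq[symmetric] using f(1) by (simp add: linear_add linear_scale)
    then have "f p + c = (1 - u) * (f q + c) + u * (f a + c)" by (simp add: algebra_simps)
    then have "snd w \<le> f p + c" using le u by (simp add: w)
    \<comment> \<open>The lower hull bounds the height of \<open>w\<close> from below, and the
      assumption on \<open>a\<close> bounds it from above.\<close>
    ultimately have "w = (p, f p + c)" using w by simp
    then have "w \<in> F" using SF[OF pS] by simp
    moreover have "w \<in> open_segment (q, f q + c) (a, real (\<omega> a))"
      using u aS qS by (auto simp: in_segment w_def intro!: exI[of _ u])
    ultimately have "(a, real (\<omega> a)) \<in> F"
      using face_ofD[OF F(1)] \<open>(q, f q + c) \<in> ?Q\<close> aQ by blast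
    then show False using F(3) aS by force
  qed
  then show "\<exists>f c. linear f \<and> (\<forall>v\<in>V. f v + c = real (\<omega> v)) \<and>
        (\<forall>a\<in>lattice_points P - V. f a + c < real (\<omega> a))"
    using f by blast
qed

text \<open>The graph of the interpolant is a hyperplane that supports the lifted polytope, and
  among the lifted lattice points it contains only those over \<open>V\<close>.\<close>

lemma lifted_simplex_is_lower_face:
  fixes f :: "real ^ 'd \<Rightarrow> real"
  assumes fin: "finite (lattice_points P)" and VA: "V \<subseteq> lattice_points P" and f: "linear f"
    and on: "\<And>v. v \<in> V \<Longrightarrow> f v + c = real (\<omega> v)"
    and off: "\<And>a. a \<in> lattice_points P - V \<Longrightarrow> f a + c < real (\<omega> a)"
  shows "(\<lambda>x. (x, f x + c)) ` (convex hull V) face_of lifted_polytope P \<omega>" (is "?G face_of ?Q")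
    and "\<And>x h. (x, h) \<in> lifted_polytope P \<omega> \<Longrightarrow> f x + c \<le> h"
proof -
  \<comment> \<open>A normal vector of the graph: \<open>adjoint f 1\<close> represents
    \<open>f\<close> as an inner product, so pairing with \<open>n\<close> gives
    \<open>h - f x\<close>.\<close>
  define n where "n = (- adjoint f 1, 1 :: real)"
  have n: "n \<bullet> (x, h) = h - f x" for x h
    using adjoint_works[OF f, of x 1] by (simp add: n_def inner_commute)
  have above: "f a + c \<le> real (\<omega> a)" if "a \<in> lattice_points P" for a
    using on off that by (cases "a \<in> V") (auto simp: less_imp_le)
  have "?Q \<subseteq> {z. n \<bullet> z \<ge> c}"
    unfolding lifted_polytope_def
    by (rule hull_minimal) (use above in \<open>auto simp: n convex_halfspace_ge algebra_simps\<close>)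
  then have ge: "\<And>z. z \<in> ?Q \<Longrightarrow> n \<bullet> z \<ge> c" by blast
  then show "\<And>x h. (x, h) \<in> ?Q \<Longrightarrow> f x + c \<le> h" by (force simp: n)
  let ?F = "?Q \<inter> {z. n \<bullet> z = c}"
  have F: "?F face_of ?Q"
    using convex_lifted_polytope ge by (rule face_of_Int_supporting_hyperplane_ge)
  obtain B where B: "B \<subseteq> lattice_points P" "?F = convex hull ((\<lambda>a. (a, real (\<omega> a))) ` B)"
    using lifted_polytope_face[OF fin F] .
  have "a \<in> V" if "a \<in> B" for a
  proof (rule ccontr)
    assume "a \<notin> V"
    have "(a, real (\<omega> a)) \<in> ?F" unfolding B(2) using that by (intro hull_inc) auto
    then show False using off[of a] \<open>a \<notin> V\<close> that B(1) by (auto simp: n)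
  qed
  then have "fst ` ?F \<subseteq> convex hull V"
    unfolding B(2) fst_convex_hull_graph by (intro hull_mono subsetI)
  then have "?F \<subseteq> ?G" by (force simp: n)
  moreover have "?G \<subseteq> ?F"
  proof -
    have "convex hull V \<subseteq> {x. (x, f x + c) \<in> ?Q}"
      using on VA by (intro hull_minimal convex_affine_graph_vimage f convex_lifted_polytope)
        (auto simp: lifted_polytope_def intro!: hull_inc)
    then show ?thesis by (auto simp: n)
  qed
  ultimately show "?G face_of ?Q" using F by simp
qed

text \<open>The lifted full-dimensional simplices are lower faces that cover everything. Both
  inclusions start from a relative interior point of a cell and a lifted simplex over it: the cell
  must then be a face of that simplex, and faces correspond under lifting and projection.\<close>

lemma locally_convex_imp_induces:
  fixes T :: "(real ^ 'd) set set"
  assumes T: "simplicial_complex T" and UT: "\<Union> T = P" and "convex P" "aff_dim P = int CARD('d)"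
    and A: "complex_vertices T = lattice_points P"
    and \<omega>: "locally_convex_heights P \<omega> T"
  shows "induces P \<omega> T"
proof -
  let ?Q = "lifted_polytope P \<omega>"
  have fin: "finite (lattice_points P)" using finite_complex_vertices[OF T] A by simp
  have faceT: "F \<in> T" if "F face_of S" "S \<in> T" for F S
    using T that unfolding simplicial_complex_def by blast
  have cover: "\<exists>V f c. convex hull V \<in> T \<and> x \<in> convex hull V \<and> linear f \<and>
      (\<lambda>x. (x, f x + c)) ` (convex hull V) face_of ?Q \<and> (\<forall>x h. (x, h) \<in> ?Q \<longrightarrow> f x + c \<le> h)"
    if x: "x \<in> P" for x
  proof -
    obtain V where V: "full_simplex T V" "x \<in> convex hull V"
      using full_simplices_cover[OF T, unfolded UT, OF assms(3,4) x] .
    obtain f c where f: "linear f" "\<And>v. v \<in> V \<Longrightarrow> f v + c = real (\<omega> v)"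
      "\<And>a. a \<in> lattice_points P - V \<Longrightarrow> f a + c < real (\<omega> a)"
      using \<omega> V(1) unfolding locally_convex_heights_def by blast
    have "V \<subseteq> lattice_points P"
      using simplex_vertices_eq[OF T, of V] V(1) A by (auto simp: full_simplex_def)
    from lifted_simplex_is_lower_face[OF fin this f] show ?thesis
      using V f(1) unfolding full_simplex_def
      by (intro exI[of _ V] exI[of _ f] exI[of _ c] conjI allI impI) simp_all
  qed
  have fstQ: "fst ` ?Q \<subseteq> P"
  proof -
    have "fst ` ?Q = convex hull (lattice_points P)"
      unfolding lifted_polytope_def by (rule fst_convex_hull_graph)
    also have "\<dots> \<subseteq> P" using \<open>convex P\<close> by (intro hull_minimal) (auto simp: lattice_points_def)
    finally show ?thesis .
  qed
  have "\<exists>F. S = fst ` F \<and> F face_of ?Q \<and> F \<subseteq> lower_hull ?Q" if S: "S \<in> T" for S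
  proof (cases "S = {}")
    case True
    then show ?thesis by (intro exI[of _ "{}"]) auto
  next
    case False
    have "convex S" using T S by (auto simp: simplicial_complex_def simplex)
    then obtain p where p: "p \<in> rel_interior S" using False rel_interior_eq_empty by blast
    then have "p \<in> P" using rel_interior_subset S UT by blast
    then obtain V f c where V: "convex hull V \<in> T" "p \<in> convex hull V" "linear f"
      and face: "(\<lambda>x. (x, f x + c)) ` (convex hull V) face_of ?Q"
      and low: "\<forall>x h. (x, h) \<in> ?Q \<longrightarrow> f x + c \<le> h"
      using cover[OF \<open>p \<in> P\<close>] by (elim exE conjE) (rule that)
    have I: "S \<inter> convex hull V face_of S" "convex hull V \<inter> S face_of convex hull V"
      using T S V(1) unfolding simplicial_complex_def by blast+
    \<comment> \<open>This common face contains \<open>p\<close>, a relative interior point of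
      \<open>S\<close>, so it is all of \<open>S\<close>.\<close>
    have "S \<subseteq> S \<inter> convex hull V"
      using I(1) by (rule subset_of_face_of) (use p V(2) rel_interior_subset in auto)
    then have "convex hull V \<inter> S = S" by blast
    then have "S face_of convex hull V" using I(2) by simp
    then have "(\<lambda>x. (x, f x + c)) ` S face_of ?Q"
      using face_of_affine_graph[OF V(3)] face face_of_trans by blast
    moreover have "(\<lambda>x. (x, f x + c)) ` S \<subseteq> lower_hull ?Q"
      using face_of_imp_subset[OF calculation] low by (auto simp: lower_hull_def)
    moreover have "S = fst ` (\<lambda>x. (x, f x + c)) ` S" by (simp add: image_image)
    ultimately show ?thesis by blast
  qed
  moreover have "fst ` F \<in> T" if F: "F face_of ?Q" "F \<subseteq> lower_hull ?Q" for F
  proof (cases "F = {}")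
    case True
    \<comment> \<open>The empty face projects to the empty simplex, which is in \<open>T\<close> as
      a face of any simplex; one exists because the dimension makes \<open>P\<close>
      nonempty.\<close>
    obtain x where "x \<in> P" using assms(4) by (cases "P = {}") auto
    then obtain S where "S \<in> T" using UT by blast
    then show ?thesis using True faceT[of "{}" S] by simp
  next
    case False
    then obtain p h where p: "(p, h) \<in> rel_interior F"
      using rel_interior_eq_empty[OF face_of_imp_convex[OF F(1)]] by auto
    then have pF: "(p, h) \<in> F" using rel_interior_subset by blast
    then have "p \<in> P" using fstQ face_of_imp_subset[OF F(1)] by force
    then obtain V f c where V: "convex hull V \<in> T" "p \<in> convex hull V" "linear f"
      and face: "(\<lambda>x. (x, f x + c)) ` (convex hull V) face_of ?Q" (is "?G face_of _")
      and low: "\<forall>x h. (x, h) \<in> ?Q \<longrightarrow> f x + c \<le> h"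
      using cover[OF \<open>p \<in> P\<close>] by (elim exE conjE) (rule that)
    have pG: "(p, f p + c) \<in> ?G" using V(2) by blast
    then have "(p, f p + c) \<in> ?Q" using face_of_imp_subset[OF face] by blast
    moreover have "(p, h) \<in> lower_hull ?Q" using pF F(2) by blast
    \<comment> \<open>Over \<open>p\<close>, both \<open>F\<close> and the lifted simplex attain the
      minimal height of the lifted polytope.\<close>
    ultimately have "h = f p + c" using low by (auto simp: lower_hull_def intro: antisym)
    then have "F \<subseteq> ?G"
      using subset_of_face_of[OF face face_of_imp_subset[OF F(1)]] p pG by blast
    then have "F face_of ?G" using F(1) face by (simp add: face_of_face)
    moreover have eq: "(\<lambda>x. (x, f x + c)) ` fst ` F = F" using \<open>F \<subseteq> ?G\<close> by force
    ultimately have "(\<lambda>x. (x, f x + c)) ` fst ` F face_of ?G" unfolding eq by simp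
    then have "fst ` F face_of convex hull V" by (simp only: face_of_affine_graph[OF V(3)])
    then show ?thesis using faceT V(1) by blast
  qed
  ultimately show ?thesis unfolding induces_def by blast
qed

section \<open>Colors of a simplex and the final choice of heights\<close>

text \<open>Any two vertices of a simplex span an edge of \<open>T\<close>, so a proper coloring is
  injective on the \<open>CARD('d) + 1\<close> vertices of a full-dimensional simplex and exhausts
  the colors.\<close>

lemma proper_coloring_surj:
  fixes T :: "(real ^ 'd) set set"
  assumes T: "simplicial_complex T" and A: "complex_vertices T = lattice_points P"
    and l: "proper_coloring T P l" and V: "full_simplex T V"
  shows "{0..CARD('d)} \<subseteq> l ` lattice_points P"
proof -
  have indep: "\<not> affine_dependent V" and VT: "convex hull V \<in> T" and card: "card V = CARD('d) + 1"
    using V by (auto simp: full_simplex_def)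
  have VA: "V \<subseteq> lattice_points P" using simplex_vertices_eq[OF T indep VT] A by auto
  have "inj_on l V"
  proof (rule inj_onI, rule ccontr)
    fix a b assume ab: "a \<in> V" "b \<in> V" "l a = l b" "a \<noteq> b"
    have "convex hull {a, b} face_of convex hull V"
      unfolding face_of_convex_hull_affine_independent[OF indep]
      using ab by (intro exI[of _ "{a, b}"]) simp
    then have "closed_segment a b \<in> T"
      using T VT unfolding simplicial_complex_def segment_convex_hull by blast
    then show False using l ab unfolding proper_coloring_def by blast
  qed
  then have "card (l ` V) = card {0..CARD('d)}" using card by (simp add: card_image)
  moreover have "l ` V \<subseteq> {0..CARD('d)}" using l VA by (auto simp: proper_coloring_def)
  ultimately have "l ` V = {0..CARD('d)}" by (intro card_subset_eq) auto
  then show ?thesis using VA by blast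
qed

theorem proposition4:
  fixes P :: "(real ^ 'd) set"
    and T :: "(real ^ 'd) set set"
    and l :: "real ^ 'd \<Rightarrow> nat"
    and \<kappa> :: "real ^ 'd \<Rightarrow> real"
  assumes "lattice_polytope P"
    and "aff_dim P = int CARD('d)"
    and "lattice_triangulation_of T P"
    and "regular_triangulation T P"
    and "dense_triangulation T P"
    and "foldable T P"
    and "proper_coloring T P l"
    and "\<And>a. a \<in> lattice_points P \<Longrightarrow> \<kappa> a > 0"
  shows "\<exists>\<omega> :: real ^ 'd \<Rightarrow> nat. induces P \<omega> T \<and>
           finite {t :: real. t \<noteq> 0 \<and>
             (\<exists>x :: complex ^ 'd. (\<forall>j. x $ j \<noteq> 0) \<and>
                (\<forall>i \<in> {0..CARD('d)}. color_poly P l \<kappa> \<omega> t i x = 0))}"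
proof -
  have T: "simplicial_complex T" and UT: "\<Union> T = P"
    using assms(3) by (simp_all add: lattice_triangulation_of_def)
  have A: "complex_vertices T = lattice_points P"
    using assms(5) by (simp add: dense_triangulation_def)
  have conv: "convex P" using assms(1) by (auto simp: lattice_polytope_def)
  have fin: "finite (lattice_points P)" using finite_complex_vertices[OF T] A by simp
  obtain x where x: "x \<in> P" using assms(2) by (cases "P = {}") auto
  obtain V where V: "full_simplex T V"
    using full_simplices_cover[OF T, unfolded UT, OF conv assms(2) x] .
  note surj = proper_coloring_surj[OF T A assms(7) V]
  obtain \<omega> where "induces P \<omega> T" using assms(4) by (auto simp: regular_triangulation_def)
  then have \<omega>: "locally_convex_heights P \<omega> T" by (rule induces_imp_locally_convex[OF T A])
  have "\<forall>a\<in>lattice_points P. \<kappa> a \<noteq> 0" using assms(8) by fastforce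
  from generic_heights_finite_solvable[where \<omega> = \<omega>, OF fin surj this]
  obtain \<eta> K0 where K0: "\<forall>K>K0. finite {t :: real. t \<noteq> 0 \<and>
             (\<exists>x :: complex ^ 'd. (\<forall>j. x $ j \<noteq> 0) \<and>
                (\<forall>i \<in> {0..CARD('d)}. color_poly P l \<kappa> (\<lambda>a. K * \<omega> a + \<eta> a) t i x = 0))}"
    by (elim exE) (rule that)
  obtain K1 where K1: "\<And>K. K > K1 \<Longrightarrow> locally_convex_heights P (\<lambda>a. K * \<omega> a + \<eta> a) T"
    using locally_convex_heights_perturb[OF T A \<omega>, of \<eta>] by blast
  \<comment> \<open>Beyond \<open>K0\<close> the exceptional set is finite, and beyond
    \<open>K1\<close> the perturbed heights still induce \<open>T\<close>; both bounds are strict,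
    hence the successor.\<close>
  let ?K = "Suc (max K0 K1)"
  have "induces P (\<lambda>a. ?K * \<omega> a + \<eta> a) T"
    by (rule locally_convex_imp_induces[OF T UT conv assms(2) A K1]) simp
  moreover have "?K > K0" by simp
  note K0[rule_format, OF this]
  ultimately show ?thesis by (intro exI[of _ "\<lambda>a. ?K * \<omega> a + \<eta> a"] conjI)
qed

end
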